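(* There exists a function $\varepsilon:\mathbb{Z}_{>0}\to\mathbb{R}$ with $\varepsilon(n) = O(n^{-3/2})$ as $n\to\infty$ (the implied constant being absolute, in particular independent of $r$) such that for all positive integers $n$ and $r$, \[ \mathsf{s}_{2n}(C_n^r) > \frac{n}{2}\left[\frac{5}{4} - \varepsilon(n)\right]^r . \] Equivalently, there is a sequence of length at least $\frac{n}{2}\left[\frac{5}{4} - \varepsilon(n)\right]^r$ of elements of $C_n^r$ containing no zero-sum subsequence of length $2n$.
   Context: $C_n = \mathbb{Z}/n\mathbb{Z}$ denotes the cyclic group of order $n$, and $C_n^r$ its $r$-fold direct product. For a finite abelian group $G$ with exponent $\exp(G)=n$ (the largest order of an element of $G$) and a positive integer $k$, the generalized Erdős–Ginzburg–Ziv constant $\mathsf{s}_{kn}(G)$ is the smallest integer $m$ such that every sequence (elements may repeat) of $m$ elements of $G$ contains a subsequence of length $kn$ whose terms sum to zero in $G$. Note $\exp(C_n^r)=n$. *)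

theory Defs
  imports Complex_Main "HOL-Library.Landau_Symbols"
    "HOL-Algebra.Product_Groups" "HOL-Algebra.FiniteProduct"
begin

definition cyclic_power :: "nat \<Rightarrow> nat \<Rightarrow> (nat \<Rightarrow> int) monoid"
  where "cyclic_power n r = product_group {..<r} (\<lambda>_. integer_mod_group n)"

text \<open>Sequences over a group are lists. A subsequence is selected by a set of positions, so
  repeated elements count with multiplicity. Groups are written multiplicatively, so
  ``sum zero'' reads ``product \<open>\<one>\<close>''.\<close>

definition has_zero_sum_subseq :: "('a, 'b) monoid_scheme \<Rightarrow> nat \<Rightarrow> 'a list \<Rightarrow> bool"
  where "has_zero_sum_subseq G L xs \<longleftrightarrow>
    (\<exists>I \<subseteq> {..<length xs}. card I = L \<and> finprod G (\<lambda>i. xs ! i) I = \<one>\<^bsub>G\<^esub>)"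

text \<open>The constant \<open>s\<^sub>L(G)\<close>. For a finite abelian group \<open>G\<close>, some \<open>m\<close> as below exists whenever
  \<open>L\<close> is a multiple of the exponent of \<open>G\<close>; otherwise the least element is unspecified.\<close>

definition egz_const :: "nat \<Rightarrow> ('a, 'b) monoid_scheme \<Rightarrow> nat"
  where "egz_const L G =
    (LEAST m. \<forall>xs. set xs \<subseteq> carrier G \<and> length xs = m \<longrightarrow> has_zero_sum_subseq G L xs)"

end

theory Submission
  imports Defs
begin

text \<open>First-moment method. Pick \<open>m\<close> random 0/1 vectors whose entries are independently 1 with
  probability 4/5. The entries of \<open>2n\<close> of them sum to 0 modulo \<open>n\<close> in a given coordinate iff
  their sum is 0, \<open>n\<close> or \<open>2n\<close>, which has probability
  \<open>(1 + (2n choose n) 4\<^sup>n + 16\<^sup>n) / 25\<^sup>n\<close>. Since \<open>(2n choose n) / 4\<^sup>n\<close> is of order \<open>n\<close> to the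
  power -1/2, this is less than \<open>q\<close> to the power \<open>- 2n\<close> for \<open>q = 5/4 (1 - \<eta>)\<close>, where \<open>\<eta>\<close> is \<open>n\<close> to the
  power -3/2. As \<open>(2n)! \<ge> (2n/3)\<close> to the power \<open>2n\<close>, a union bound over the
  \<open>2n\<close>-subsets shows that \<open>m = \<lfloor>2n q\<^sup>r / 3\<rfloor>\<close> vectors can be chosen without zero-sum subsequence.
  This \<open>m\<close> is at least \<open>n q\<^sup>r / 2\<close> once \<open>n q\<^sup>r \<ge> 6\<close>; if \<open>n q\<^sup>r / 2 \<le> 2n - 1\<close>, any sequence of
  length \<open>2n - 1\<close> will do.\<close>

section \<open>Numerical estimates for the factorial and the central binomial coefficient\<close>

text \<open>Passing from \<open>k\<close> to \<open>k + 1\<close> multiplies the left side by (1 +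
  1/k)^k (k + 1)/3, which is at most k + 1 because (1 + 1/k)^k \<le> e \<le> 3.\<close>

lemma power_div_3_le_fact: "(real k / 3) ^ k \<le> fact k"
proof (induction k)
  case 0
  then show ?case by simp
next
  case (Suc k)
  show ?case
  proof (cases "k = 0")
    case True
    then show ?thesis by simp
  next
    case False
    have "(1 + 1 / real k) ^ k \<le> exp 1"
      using exp_ge_one_plus_x_over_n_power_n[of k 1] False by simp
    then have e: "(1 + 1 / real k) ^ k \<le> 3"
      using exp_le by linarith
    have "real (Suc k) / 3 = real k / 3 * (1 + 1 / real k)"
      using False by (simp add: field_simps)
    then have "(real (Suc k) / 3) ^ Suc k = (real k / 3) ^ k * (1 + 1 / real k) ^ k * (real (Suc k) / 3)"
      by (simp only: power_Suc2 power_mult_distrib)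
    also have "\<dots> \<le> fact k * 3 * (real (Suc k) / 3)"
      using Suc.IH e by (intro mult_right_mono mult_mono) auto
    finally show ?thesis by simp
  qed
qed

text \<open>The recursion (n + 1) d = 2 (2n + 1) c for consecutive central coefficients reduces the
  induction step to (2n + 1)(2n + 3) \<le> (2n + 2)^2; the factor 2n + 1 makes the induction
  close.\<close>

lemma central_binomial_sq_le: "((2 * n) choose n) ^ 2 * (2 * n + 1) \<le> 16 ^ n"
proof (induction n)
  case 0
  then show ?case by simp
next
  case (Suc n)
  define c d where "c = (2 * n) choose n" and "d = (2 * Suc n) choose (Suc n)"
  have "Suc n * d = (2 * n + 2) * ((2 * n + 1) choose n)"
    using Suc_times_binomial_eq[of "2 * n + 1" n] by (simp add: d_def)
  moreover have "Suc n * ((2 * n + 1) choose n) = (2 * n + 1) * c"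
    using binomial_absorb_comp[of "2 * n + 1" n] by (simp add: c_def)
  ultimately have d: "Suc n * d = 2 * (2 * n + 1) * c"
    by simp
  have "(Suc n)\<^sup>2 * (d\<^sup>2 * (2 * Suc n + 1)) = (Suc n * d)\<^sup>2 * (2 * n + 3)"
    by (simp add: power2_eq_square algebra_simps)
  also have "\<dots> = 4 * ((2 * n + 1) * (2 * n + 3)) * (c\<^sup>2 * (2 * n + 1))"
    unfolding d by (simp add: power2_eq_square algebra_simps)
  also have "\<dots> \<le> 4 * (4 * (Suc n)\<^sup>2) * 16 ^ n"
  proof (rule mult_le_mono)
    show "4 * ((2 * n + 1) * (2 * n + 3)) \<le> 4 * (4 * (Suc n)\<^sup>2)"
      by (simp add: power2_eq_square algebra_simps)
    show "c\<^sup>2 * (2 * n + 1) \<le> 16 ^ n"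
      unfolding c_def by (rule Suc.IH)
  qed
  also have "\<dots> = (Suc n)\<^sup>2 * 16 ^ Suc n"
    by simp
  finally show ?case
    by (simp add: d_def)
qed

text \<open>Both lower-order terms are below 16^n / sqrt n: the middle one by the central binomial
  estimate, the term 1 because sqrt n \<le> 16^n.\<close>

lemma column_weight_bound:
  assumes "n \<ge> 1"
  shows "real (1 + ((2 * n) choose n) * 4 ^ n + 16 ^ n) < 16 ^ n * (1 + 2 / sqrt n)"
proof -
  define c where "c = real ((2 * n) choose n)"
  have "c\<^sup>2 * (2 * real n + 1) \<le> 16 ^ n"
    using of_nat_mono[OF central_binomial_sq_le[of n], where 'a = real]
    by (simp add: c_def algebra_simps)
  moreover have "c\<^sup>2 * real n < c\<^sup>2 * (2 * real n + 1)"
    using assms by (intro mult_strict_left_mono) (auto simp: c_def)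
  moreover have "(16::real) ^ n = (4 ^ n)\<^sup>2"
    by (simp add: power2_eq_square flip: power_mult_distrib)
  ultimately have "(c * sqrt n)\<^sup>2 < (4 ^ n)\<^sup>2"
    by (simp add: power_mult_distrib)
  then have c: "c * sqrt n < 4 ^ n"
    by (rule power2_less_imp_less) simp
  have "sqrt n \<le> real n"
    using assms by (simp add: real_sqrt_le_iff real_le_lsqrt self_le_power)
  also have "real n < 2 ^ n"
    by (rule of_nat_less_two_power)
  also have "(2::real) ^ n \<le> 16 ^ n"
    by (rule power_mono) auto
  finally have s: "sqrt n \<le> 16 ^ n" by simp
  have "(1 + c * 4 ^ n) * sqrt n = sqrt n + c * sqrt n * 4 ^ n"
    by (simp add: algebra_simps)
  also have "\<dots> < 16 ^ n + 4 ^ n * 4 ^ n"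
    using s c by (intro add_le_less_mono mult_strict_right_mono) simp_all
  also have "\<dots> = 16 ^ n * 2"
    by (simp flip: power_mult_distrib)
  finally have "1 + c * 4 ^ n < 16 ^ n * (2 / sqrt n)"
    using assms by (simp add: field_simps)
  then show ?thesis
    by (simp add: c_def algebra_simps)
qed

text \<open>The exponent -3/2 gives n e = 1 / sqrt n, so (1 - e)^(2n) \<le> exp (-2 / sqrt n). This
  absorbs the factor 1 + 2 / sqrt n \<le> exp (2 / sqrt n) of the column weight.\<close>

lemma base_power_bound:
  assumes n: "n \<ge> 1"
  shows "(5/4 - 5/4 * real n powr (-3/2)) ^ (2 * n)
    * real (1 + ((2 * n) choose n) * 4 ^ n + 16 ^ n) < 25 ^ n"
proof -
  define e where "e = real n powr (-3/2)"
  \<comment> \<open>Keeps the base 1 - e nonnegative for the comparison of powers; it is 0 at n =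
    1.\<close>
  have e1: "e \<le> 1"
    using n powr_mono[of "-3/2" 0 "real n"] by (simp add: e_def)
  have "real n * e = real n powr (- (1/2))"
    using n powr_add[of "real n" 1 "-3/2"] by (simp add: e_def)
  then have ne: "real n * e = 1 / sqrt n"
    by (simp add: powr_minus powr_half_sqrt inverse_eq_divide)
  have "(1 - e) ^ (2 * n) \<le> exp (- e) ^ (2 * n)"
    using e1 exp_ge_add_one_self[of "- e"] by (intro power_mono) auto
  also have "\<dots> = exp (- (2 / sqrt n))"
    using ne by (simp flip: exp_of_nat_mult)
  finally have p: "(1 - e) ^ (2 * n) \<le> exp (- (2 / sqrt n))" .
  have "(5/4 - 5/4 * e) ^ (2 * n) = ((5/4) * (1 - e)) ^ (2 * n)"
    by (simp only: right_diff_distrib mult_1_right)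
  also have "\<dots> = (25/16) ^ n * (1 - e) ^ (2 * n)"
    unfolding power_mult_distrib by (simp add: power_mult power2_eq_square)
  also have "\<dots> \<le> (25/16) ^ n * exp (- (2 / sqrt n))"
    using p by simp
  finally have "(5/4 - 5/4 * e) ^ (2 * n) * real (1 + ((2 * n) choose n) * 4 ^ n + 16 ^ n)
      \<le> (25/16) ^ n * exp (- (2 / sqrt n)) * real (1 + ((2 * n) choose n) * 4 ^ n + 16 ^ n)"
    by (rule mult_right_mono) simp
  also have "\<dots> < (25/16) ^ n * exp (- (2 / sqrt n)) * (16 ^ n * (1 + 2 / sqrt n))"
    by (intro mult_strict_left_mono column_weight_bound n) simp
  also have "\<dots> = 25 ^ n * (exp (- (2 / sqrt n)) * (1 + 2 / sqrt n))"
    by (simp add: power_divide)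
  also have "\<dots> \<le> 25 ^ n * (exp (- (2 / sqrt n)) * exp (2 / sqrt n))"
    using exp_ge_add_one_self[of "2 / sqrt n"] by (intro mult_left_mono) auto
  also have "\<dots> = 25 ^ n"
    by (simp flip: exp_add)
  finally show ?thesis
    by (simp add: e_def)
qed

section \<open>Counting words and matrices with zero-sum index sets\<close>

text \<open>A letter in \<open>{..<5}\<close> stands for the residue 0 if it is 0 and for 1 otherwise, so that
  uniform counting of words gives the entry 1 the probability 4/5. This is the \<open>p\<close> with
  \<open>p\<^sup>2 = 4 p (1 - p)\<close>, which balances the two dominant column sums \<open>2n\<close> and \<open>n\<close>.\<close>

lemma card_words_with_support:
  assumes "I \<subseteq> {..<m}" "S \<subseteq> I"
  shows "card {g \<in> {..<m} \<rightarrow>\<^sub>E {..<5::nat}. {i \<in> I. g i \<noteq> 0} = S} = 5 ^ (m - card I) * 4 ^ card S"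
proof -
  \<comment> \<open>The condition on the support splits by position: four letters on
    \<open>S\<close>, one on \<open>I - S\<close>, all five outside \<open>I\<close>.\<close>
  let ?T = "\<lambda>i. if i \<in> S then {1..<5} else if i \<in> I then {0} else {..<5::nat}"
  have "{g \<in> {..<m} \<rightarrow>\<^sub>E {..<5::nat}. {i \<in> I. g i \<noteq> 0} = S} = Pi\<^sub>E {..<m} ?T"
  proof (rule Set.set_eqI)
    fix g :: "nat \<Rightarrow> nat"
    have "g i \<in> ?T i \<longleftrightarrow> g i \<in> {..<5} \<and> (i \<in> I \<longrightarrow> (g i \<noteq> 0 \<longleftrightarrow> i \<in> S))" for i
      using assms by auto
    moreover have "{i \<in> I. g i \<noteq> 0} = S \<longleftrightarrow> (\<forall>i\<in>{..<m}. i \<in> I \<longrightarrow> (g i \<noteq> 0 \<longleftrightarrow> i \<in> S))"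
      using assms by blast
    ultimately show "g \<in> {g \<in> {..<m} \<rightarrow>\<^sub>E {..<5}. {i \<in> I. g i \<noteq> 0} = S} \<longleftrightarrow> g \<in> Pi\<^sub>E {..<m} ?T"
      unfolding mem_Collect_eq PiE_iff by blast
  qed
  then have "card {g \<in> {..<m} \<rightarrow>\<^sub>E {..<5::nat}. {i \<in> I. g i \<noteq> 0} = S} = (\<Prod>i<m. card (?T i))"
    by (simp add: card_PiE)
  also have "\<dots> = (\<Prod>i\<in>{..<m} - I. card (?T i)) * (\<Prod>i\<in>I. card (?T i))"
    using assms by (intro prod.subset_diff) auto
  also have "(\<Prod>i\<in>I. card (?T i)) = (\<Prod>i\<in>I - S. card (?T i)) * (\<Prod>i\<in>S. card (?T i))"
    using assms finite_subset[OF assms(1)] by (intro prod.subset_diff) auto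
  also have "(\<Prod>i\<in>S. card (?T i)) = 4 ^ card S"
    by simp
  also have "(\<Prod>i\<in>I - S. card (?T i)) = 1"
    by (intro prod.neutral) auto
  also have "(\<Prod>i\<in>{..<m} - I. card (?T i)) = (\<Prod>i\<in>{..<m} - I. 5)"
    using assms by (intro prod.cong) auto
  also have "\<dots> = 5 ^ (m - card I)"
    using assms finite_subset[OF assms(1)] by (simp add: card_Diff_subset)
  finally show ?thesis by simp
qed

text \<open>A multiple of \<open>n\<close> that is at most \<open>2 * n\<close> is 0,
  \<open>n\<close> or \<open>2 * n\<close>. Sorting the words by their support in \<open>I\<close>
  gives one summand for each of these sizes.\<close>

lemma card_bad_columns_le:
  assumes I: "I \<subseteq> {..<m}" "card I = 2 * n" and n: "n \<ge> 1"
  shows "card {g \<in> {..<m} \<rightarrow>\<^sub>E {..<5::nat}. n dvd card {i \<in> I. g i \<noteq> 0}}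
    \<le> 5 ^ (m - 2 * n) * (1 + ((2 * n) choose n) * 4 ^ n + 16 ^ n)"
proof -
  let ?W = "\<lambda>S. {g \<in> {..<m} \<rightarrow>\<^sub>E {..<5::nat}. {i \<in> I. g i \<noteq> 0} = S}"
  let ?K = "\<lambda>k. {S. S \<subseteq> I \<and> card S = k}"
  have sixteen: "(4::nat) ^ (2 * n) = 16 ^ n"
    by (simp add: power_mult)
  have finI: "finite I" using I(1) finite_subset by blast
  have finK: "finite (?K k)" for k
    using finI by simp
  have "{g \<in> {..<m} \<rightarrow>\<^sub>E {..<5::nat}. n dvd card {i \<in> I. g i \<noteq> 0}}
      \<subseteq> (\<Union>k\<in>{0, n, 2 * n}. \<Union>S\<in>?K k. ?W S)"
  proof
    fix g assume g: "g \<in> {g \<in> {..<m} \<rightarrow>\<^sub>E {..<5::nat}. n dvd card {i \<in> I. g i \<noteq> 0}}"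
    then obtain q where q: "card {i \<in> I. g i \<noteq> 0} = n * q" by auto
    have "card {i \<in> I. g i \<noteq> 0} \<le> 2 * n"
      using card_mono[OF finI, of "{i \<in> I. g i \<noteq> 0}"] I by auto
    with q n have "q \<le> 2"
      by (metis mult.commute mult_le_cancel2 less_eq_Suc_le One_nat_def)
    then have "q \<in> {0, 1, 2}" by auto
    with q have "card {i \<in> I. g i \<noteq> 0} \<in> {0, n, 2 * n}"
      by auto
    with g show "g \<in> (\<Union>k\<in>{0, n, 2 * n}. \<Union>S\<in>?K k. ?W S)"
      by (intro UN_I[of "card {i \<in> I. g i \<noteq> 0}"] UN_I[of "{i \<in> I. g i \<noteq> 0}"]) auto
  qed
  moreover have fin: "finite (?W S)" for S
    by (rule finite_subset[of _ "{..<m} \<rightarrow>\<^sub>E {..<5::nat}"]) (auto intro: finite_PiE)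
  then have "finite (\<Union>k\<in>{0, n, 2 * n}. \<Union>S\<in>?K k. ?W S)"
    using finK by (intro finite_UN_I) simp_all
  ultimately have "card {g \<in> {..<m} \<rightarrow>\<^sub>E {..<5::nat}. n dvd card {i \<in> I. g i \<noteq> 0}}
      \<le> card (\<Union>k\<in>{0, n, 2 * n}. \<Union>S\<in>?K k. ?W S)"
    by (intro card_mono)
  also have "\<dots> \<le> (\<Sum>k\<in>{0, n, 2 * n}. card (\<Union>S\<in>?K k. ?W S))"
    by (intro card_UN_le) simp
  also have "\<dots> \<le> (\<Sum>k\<in>{0, n, 2 * n}. \<Sum>S\<in>?K k. card (?W S))"
    using finK by (intro sum_mono card_UN_le)
  also have "\<dots> = (\<Sum>k\<in>{0, n, 2 * n}. ((2 * n) choose k) * (5 ^ (m - 2 * n) * 4 ^ k))"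
  proof (intro sum.cong refl)
    fix k
    have "(\<Sum>S\<in>?K k. card (?W S)) = (\<Sum>S\<in>?K k. 5 ^ (m - 2 * n) * 4 ^ k)"
      using I card_words_with_support[OF I(1)] by (intro sum.cong refl) force
    then show "(\<Sum>S\<in>?K k. card (?W S)) = ((2 * n) choose k) * (5 ^ (m - 2 * n) * 4 ^ k)"
      using n_subsets[OF finI, of k] I by simp
  qed
  also have "\<dots> = 5 ^ (m - 2 * n) * (1 + ((2 * n) choose n) * 4 ^ n + 16 ^ n)"
    \<comment> \<open>Positivity of \<open>n\<close> keeps the three sizes distinct, so the sum has
      three terms.\<close>
    using n sixteen by (simp add: algebra_simps)
  finally show ?thesis .
qed

text \<open>Union bound by counting: \<open>?B I\<close> holds the matrices in which every row has
  weight divisible by \<open>n\<close> on \<open>I\<close>. Rows are independent, hence the power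
  \<open>r\<close>, and \<open>less\<close> keeps the total below 5^(m r).\<close>

lemma ex_good_matrix:
  assumes n: "n \<ge> 1"
    and less: "(m choose (2 * n)) * (1 + ((2 * n) choose n) * 4 ^ n + 16 ^ n) ^ r < 25 ^ (n * r)"
  obtains f :: "nat \<Rightarrow> nat \<Rightarrow> nat"
  where "\<And>I. I \<subseteq> {..<m} \<Longrightarrow> card I = 2 * n \<Longrightarrow> \<exists>j<r. \<not> n dvd card {i \<in> I. f j i \<noteq> 0}"
proof -
  define A where "A = 1 + ((2 * n) choose n) * 4 ^ n + 16 ^ n"
  let ?\<Omega> = "{..<r} \<rightarrow>\<^sub>E ({..<m} \<rightarrow>\<^sub>E {..<5::nat})"
  let ?B = "\<lambda>I. {..<r} \<rightarrow>\<^sub>E {g \<in> {..<m} \<rightarrow>\<^sub>E {..<5::nat}. n dvd card {i \<in> I. g i \<noteq> 0}}"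
  let ?\<I> = "{I. I \<subseteq> {..<m} \<and> card I = 2 * n}"
  have fin: "finite ?\<I>" by simp
  have fin_bad: "finite (\<Union>I\<in>?\<I>. ?B I)"
  proof (intro finite_UN_I fin)
    fix I
    have "?B I \<subseteq> ?\<Omega>"
      by (intro PiE_mono) blast
    then show "finite (?B I)"
      by (rule finite_subset) (simp add: finite_PiE)
  qed
  have "card (\<Union>I\<in>?\<I>. ?B I) < card ?\<Omega>"
  proof (cases "?\<I> = {}")
    case True
    then show ?thesis
      unfolding True by (simp add: card_funcsetE)
  next
    case False
    then obtain I where "I \<subseteq> {..<m}" "card I = 2 * n" by auto
    \<comment> \<open>Makes the natural subtraction \<open>m - 2 * n\<close> exact, so that the
      exponents of 5 add up to \<open>m * r\<close>.\<close>
    then have m: "2 * n \<le> m"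
      using card_mono[of "{..<m}" I] by simp
    have "card (\<Union>I\<in>?\<I>. ?B I) \<le> (\<Sum>I\<in>?\<I>. card (?B I))"
      using fin by (rule card_UN_le)
    also have "\<dots> \<le> (\<Sum>I\<in>?\<I>. (5 ^ (m - 2 * n) * A) ^ r)"
    proof (rule sum_mono)
      fix I assume "I \<in> ?\<I>"
      then show "card (?B I) \<le> (5 ^ (m - 2 * n) * A) ^ r"
        using card_bad_columns_le[of I m n] n by (simp add: card_funcsetE power_mono A_def)
    qed
    also have "\<dots> = 5 ^ ((m - 2 * n) * r) * ((m choose (2 * n)) * A ^ r)"
      using n_subsets[of "{..<m}" "2 * n"]
      by (simp add: power_mult_distrib power_mult)
    also have "\<dots> < 5 ^ ((m - 2 * n) * r) * 25 ^ (n * r)"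
      using less by (simp add: A_def)
    also have "(25::nat) ^ (n * r) = 5 ^ (2 * n * r)"
      by (simp add: power_mult)
    also have "5 ^ ((m - 2 * n) * r) * 5 ^ (2 * n * r) = (5::nat) ^ (m * r)"
      using m by (simp flip: power_add add_mult_distrib)
    also have "\<dots> = card ?\<Omega>"
      by (simp add: card_funcsetE power_mult)
    finally show ?thesis .
  qed
  with card_mono[OF fin_bad, of ?\<Omega>] have "\<not> ?\<Omega> \<subseteq> (\<Union>I\<in>?\<I>. ?B I)"
    by linarith
  then obtain f where f: "f \<in> ?\<Omega>" "f \<notin> (\<Union>I\<in>?\<I>. ?B I)"
    by blast
  show ?thesis
  proof
    fix I assume "I \<subseteq> {..<m}" "card I = 2 * n"
    with f show "\<exists>j<r. \<not> n dvd card {i \<in> I. f j i \<noteq> 0}"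
      by (auto simp: PiE_iff)
  qed
qed

section \<open>Zero sums in the cyclic power and finiteness of the constant\<close>

lemma comm_group_cyclic_power: "comm_group (cyclic_power n r)"
proof (rule group.group_comm_groupI)
  show "group (cyclic_power n r)"
    by (simp add: cyclic_power_def)
qed (simp add: cyclic_power_def add.commute)

lemma carrier_cyclic_power:
  "n \<ge> 1 \<Longrightarrow> carrier (cyclic_power n r) = {..<r} \<rightarrow>\<^sub>E {0..<int n}"
  by (simp add: cyclic_power_def carrier_integer_mod_group)

lemma one_cyclic_power: "\<one>\<^bsub>cyclic_power n r\<^esub> = (\<lambda>j\<in>{..<r}. 0)"
  by (simp add: cyclic_power_def)

lemma finprod_cyclic_power:
  assumes "finite I" "f \<in> I \<rightarrow> carrier (cyclic_power n r)"
  shows "finprod (cyclic_power n r) f I = (\<lambda>j\<in>{..<r}. (\<Sum>i\<in>I. f i j) mod int n)"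
proof -
  interpret comm_group "cyclic_power n r"
    by (rule comm_group_cyclic_power)
  show ?thesis
    using assms
  proof (induction I)
    case empty
    then show ?case by (simp add: one_cyclic_power)
  next
    case (insert a I)
    have "f a \<otimes>\<^bsub>cyclic_power n r\<^esub> finprod (cyclic_power n r) f I
        = (\<lambda>j\<in>{..<r}. (\<Sum>i\<in>insert a I. f i j) mod int n)"
      using insert by (auto simp: cyclic_power_def mod_add_right_eq fun_eq_iff)
    then show ?case
      using insert by (simp add: Pi_iff)
  qed
qed

lemma has_zero_sum_subseq_cyclic_power:
  assumes "set xs \<subseteq> carrier (cyclic_power n r)"
  shows "has_zero_sum_subseq (cyclic_power n r) L xs \<longleftrightarrow>
    (\<exists>I \<subseteq> {..<length xs}. card I = L \<and> (\<forall>j<r. int n dvd (\<Sum>i\<in>I. (xs ! i) j)))"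
proof -
  have "finprod (cyclic_power n r) (\<lambda>i. xs ! i) I = \<one>\<^bsub>cyclic_power n r\<^esub>
      \<longleftrightarrow> (\<forall>j<r. int n dvd (\<Sum>i\<in>I. (xs ! i) j))" if "I \<subseteq> {..<length xs}" for I
  proof -
    have "(\<lambda>i. xs ! i) \<in> I \<rightarrow> carrier (cyclic_power n r)"
      using that assms nth_mem by blast
    then show ?thesis
      using finite_subset[OF that]
      by (auto simp: finprod_cyclic_power one_cyclic_power fun_eq_iff mod_eq_0_iff_dvd)
  qed
  then show ?thesis
    unfolding has_zero_sum_subseq_def by (intro ex_cong1) blast
qed

text \<open>Positions in a prefix select the same terms of the whole list. Hence a length that
  forces a zero sum also forces it for all longer sequences.\<close>

lemma (in comm_monoid) has_zero_sum_subseq_take: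
  assumes "set xs \<subseteq> carrier G" "has_zero_sum_subseq G L (take m xs)"
  shows "has_zero_sum_subseq G L xs"
proof -
  from assms(2) obtain I where I: "I \<subseteq> {..<length (take m xs)}" "card I = L"
      "finprod G (\<lambda>i. take m xs ! i) I = \<one>\<^bsub>G\<^esub>"
    unfolding has_zero_sum_subseq_def by blast
  have "finprod G (\<lambda>i. xs ! i) I = finprod G (\<lambda>i. take m xs ! i) I"
    using I(1) assms(1) nth_mem by (intro finprod_cong') fastforce+
  with I show ?thesis
    unfolding has_zero_sum_subseq_def by (intro exI[of _ I]) auto
qed

text \<open>By pigeonhole some element occurs \<open>2 * n\<close> times, and these copies sum to
  zero. This shows that the minimum in \<open>egz_const\<close> is attained.\<close>

lemma long_has_zero_sum_subseq:
  assumes n: "n \<ge> 1" and xs: "set xs \<subseteq> carrier (cyclic_power n r)"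
    and len: "length xs = 2 * n * n ^ r"
  shows "has_zero_sum_subseq (cyclic_power n r) (2 * n) xs"
proof -
  let ?C = "carrier (cyclic_power n r)"
  have C: "finite ?C" "card ?C = n ^ r" "?C \<noteq> {}"
    using n by (auto simp: carrier_cyclic_power card_funcsetE finite_PiE PiE_eq_empty_iff)
  have "(\<lambda>i. xs ! i) \<in> {..<length xs} \<rightarrow> ?C"
    using xs nth_mem by blast
  from pigeonhole_card[OF this _ C(1) C(3)] obtain y
    where "card ((\<lambda>i. xs ! i) -` {y} \<inter> {..<length xs}) * n ^ r \<ge> 2 * n * n ^ r"
    using len C(2) by auto
  then have "2 * n \<le> card ((\<lambda>i. xs ! i) -` {y} \<inter> {..<length xs})"
    using n by simp
  then obtain I where I: "I \<subseteq> (\<lambda>i. xs ! i) -` {y} \<inter> {..<length xs}" "card I = 2 * n"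
    by (meson obtain_subset_with_card_n)
  have "(\<Sum>i\<in>I. (xs ! i) j) = (\<Sum>i\<in>I. y j)" for j
    using I(1) by (intro sum.cong) auto
  then have "int n dvd (\<Sum>i\<in>I. (xs ! i) j)" for j
    using I(2) by simp
  then show ?thesis
    using I xs by (auto simp: has_zero_sum_subseq_cyclic_power intro!: exI[of _ I])
qed

text \<open>Otherwise the prefix of \<open>xs\<close> whose length is the constant would have a
  zero-sum subsequence, and so would \<open>xs\<close>.\<close>

lemma length_less_egz_const:
  assumes "n \<ge> 1" "set xs \<subseteq> carrier (cyclic_power n r)"
    and "\<not> has_zero_sum_subseq (cyclic_power n r) (2 * n) xs"
  shows "length xs < egz_const (2 * n) (cyclic_power n r)"
proof (rule ccontr)
  define m where "m = egz_const (2 * n) (cyclic_power n r)"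
  have m: "\<forall>ys. set ys \<subseteq> carrier (cyclic_power n r) \<and> length ys = m \<longrightarrow>
      has_zero_sum_subseq (cyclic_power n r) (2 * n) ys"
    unfolding m_def egz_const_def
    by (rule LeastI[of _ "2 * n * n ^ r"]) (use assms(1) long_has_zero_sum_subseq in blast)
  assume "\<not> length xs < egz_const (2 * n) (cyclic_power n r)"
  then have "length (take m xs) = m"
    by (simp add: m_def)
  moreover have "set (take m xs) \<subseteq> carrier (cyclic_power n r)"
    using assms(2) set_take_subset by fast
  ultimately show False
    using m assms comm_group.axioms(1)[OF comm_group_cyclic_power]
      comm_monoid.has_zero_sum_subseq_take by blast
qed

section \<open>Sequences without zero-sum subsequences and the lower bound\<close>

lemma ex_long_seq_without_zero_sum:
  fixes X :: real
  assumes n: "n \<ge> 2" and X: "real n / 2 * X > 2 * real n - 1"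
    and bound: "X ^ (2 * n) * real (1 + ((2 * n) choose n) * 4 ^ n + 16 ^ n) ^ r < 25 ^ (n * r)"
  shows "\<exists>xs. set xs \<subseteq> carrier (cyclic_power n r) \<and> real (length xs) \<ge> real n / 2 * X \<and>
    \<not> has_zero_sum_subseq (cyclic_power n r) (2 * n) xs"
proof -
  let ?A = "1 + ((2 * n) choose n) * 4 ^ n + 16 ^ n"
  \<comment> \<open>The factor 2/3 matches (2n)! \<ge> (2n/3)^(2n), so that (m choose 2n) \<le>
    m^(2n) / (2n)! \<le> X^(2n).\<close>
  define m where "m = nat \<lfloor>2 * real n * X / 3\<rfloor>"
  \<comment> \<open>From n X > 4n - 2 \<ge> 6. Then rounding down is affordable: 2nX/3 - 1 \<ge>
    nX/2.\<close>
  have nX: "real n * X > 6"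
    using X n by (simp add: field_simps)
  then have m: "real m \<le> 2 * real n * X / 3" "real m \<ge> 2 * real n * X / 3 - 1"
    unfolding m_def by linarith+
  have "real ((m choose (2 * n)) * fact (2 * n)) \<le> real m ^ (2 * n)"
    using of_nat_mono[OF binomial_fact_pow[of m "2 * n"], where 'a = real] by simp
  also have "\<dots> \<le> (real (2 * n) / 3 * X) ^ (2 * n)"
    using m by (intro power_mono) auto
  also have "\<dots> \<le> fact (2 * n) * X ^ (2 * n)"
    unfolding power_mult_distrib by (intro mult_right_mono power_div_3_le_fact) simp
  finally have "real (m choose (2 * n)) \<le> X ^ (2 * n)"
    by simp
  then have "real (m choose (2 * n)) * real ?A ^ r \<le> X ^ (2 * n) * real ?A ^ r"
    by (rule mult_right_mono) simp
  also have "\<dots> < 25 ^ (n * r)"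
    by (rule bound)
  finally have "real ((m choose (2 * n)) * ?A ^ r) < real (25 ^ (n * r))"
    by simp
  then have "(m choose (2 * n)) * ?A ^ r < 25 ^ (n * r)"
    by (simp only: of_nat_less_iff)
  then obtain f :: "nat \<Rightarrow> nat \<Rightarrow> nat" where f:
    "\<And>I. I \<subseteq> {..<m} \<Longrightarrow> card I = 2 * n \<Longrightarrow> \<exists>j<r. \<not> n dvd card {i \<in> I. f j i \<noteq> 0}"
    using ex_good_matrix[of n m r] n by auto
  define xs where "xs = map (\<lambda>i. \<lambda>j\<in>{..<r}. of_bool (f j i \<noteq> 0) :: int) [0..<m]"
  have len: "length xs = m"
    by (simp add: xs_def)
  \<comment> \<open>The entry 1 is a reduced residue modulo \<open>n\<close> because
    \<open>n\<close> is at least 2.\<close>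
  have carr: "set xs \<subseteq> carrier (cyclic_power n r)"
    using n by (auto simp: xs_def carrier_cyclic_power PiE_iff extensional_def split: if_splits)
  have "\<not> has_zero_sum_subseq (cyclic_power n r) (2 * n) xs"
  proof
    assume "has_zero_sum_subseq (cyclic_power n r) (2 * n) xs"
    then obtain I where I: "I \<subseteq> {..<m}" "card I = 2 * n"
        and dvd: "\<And>j. j < r \<Longrightarrow> int n dvd (\<Sum>i\<in>I. (xs ! i) j)"
      using carr len by (auto simp: has_zero_sum_subseq_cyclic_power)
    from f[OF I] obtain j where j: "j < r" "\<not> n dvd card {i \<in> I. f j i \<noteq> 0}"
      by blast
    have "(\<Sum>i\<in>I. (xs ! i) j) = (\<Sum>i\<in>I. of_bool (f j i \<noteq> 0))"
      using I(1) j(1) by (intro sum.cong) (auto simp: xs_def)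
    also have "\<dots> = int (card {i \<in> I. f j i \<noteq> 0})"
      using finite_subset[OF I(1)] by (simp add: Int_def)
    finally show False
      using dvd[OF j(1)] j(2) by simp
  qed
  moreover have "real (length xs) \<ge> real n / 2 * X"
    using m nX len by linarith
  ultimately show ?thesis
    using carr by blast
qed

lemma ex_seq_without_zero_sum:
  assumes n: "n \<ge> 1" and r: "r \<ge> 1"
  shows "\<exists>xs. set xs \<subseteq> carrier (cyclic_power n r) \<and>
    real (length xs) \<ge> real n / 2 * (5/4 - 5/4 * real n powr (-3/2)) ^ r \<and>
    \<not> has_zero_sum_subseq (cyclic_power n r) (2 * n) xs"
proof (cases "real n / 2 * (5/4 - 5/4 * real n powr (-3/2)) ^ r \<le> 2 * real n - 1")
  case True
  \<comment> \<open>Too short to have \<open>2 * n\<close> positions at all.\<close>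
  let ?xs = "replicate (2 * n - 1) \<one>\<^bsub>cyclic_power n r\<^esub>"
  interpret comm_group "cyclic_power n r"
    by (rule comm_group_cyclic_power)
  have "\<not> has_zero_sum_subseq (cyclic_power n r) (2 * n) ?xs"
  proof
    assume "has_zero_sum_subseq (cyclic_power n r) (2 * n) ?xs"
    then obtain I where "I \<subseteq> {..<2 * n - 1}" "card I = 2 * n"
      by (auto simp: has_zero_sum_subseq_def)
    with card_mono[of "{..<2 * n - 1}" I] n show False
      by simp
  qed
  moreover have "set ?xs \<subseteq> carrier (cyclic_power n r)"
    by auto
  moreover have "real (length ?xs) = 2 * real n - 1"
    using n by (simp add: of_nat_diff)
  ultimately show ?thesis
    using True by (intro exI[of _ ?xs]) simp
next
  case False
  let ?q = "5/4 - 5/4 * real n powr (-3/2)"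
  let ?A = "1 + ((2 * n) choose n) * 4 ^ n + 16 ^ n"
  \<comment> \<open>At n = 1 the base is 0, so its positive power vanishes and the first case
    applies.\<close>
  have "n \<noteq> 1"
    using False r by (auto simp: power_0_left)
  with n have n2: "n \<ge> 2" by simp
  \<comment> \<open>Nonnegative by the even exponent, as needed to raise the strict inequality to
    the power \<open>r\<close>.\<close>
  have "0 \<le> ?q ^ (2 * n) * real ?A"
    by (simp add: power_mult)
  then have "(?q ^ (2 * n) * real ?A) ^ r < (25 ^ n) ^ r"
    using base_power_bound[OF n] r by (intro power_strict_mono) auto
  then have "(?q ^ r) ^ (2 * n) * real ?A ^ r < 25 ^ (n * r)"
    by (simp only: power_mult_distrib power_mult[symmetric] mult.commute[of r])
  then show ?thesis
    using False n2 by (intro ex_long_seq_without_zero_sum) auto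
qed

theorem theorem1:
  shows "\<exists>\<epsilon> :: nat \<Rightarrow> real.
    \<epsilon> \<in> O(\<lambda>n. real n powr (-3/2)) \<and>
    (\<forall>n r :: nat. n \<ge> 1 \<longrightarrow> r \<ge> 1 \<longrightarrow>
      real (egz_const (2 * n) (cyclic_power n r)) > real n / 2 * (5/4 - \<epsilon> n) ^ r \<and>
      (\<exists>xs. set xs \<subseteq> carrier (cyclic_power n r) \<and>
            real (length xs) \<ge> real n / 2 * (5/4 - \<epsilon> n) ^ r \<and>
            \<not> has_zero_sum_subseq (cyclic_power n r) (2 * n) xs))"
proof (intro exI[of _ "\<lambda>n. 5/4 * real n powr (-3/2)"] conjI allI impI)
  fix n r :: nat
  assume "n \<ge> 1" "r \<ge> 1"
  then show "\<exists>xs. set xs \<subseteq> carrier (cyclic_power n r) \<and>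
      real (length xs) \<ge> real n / 2 * (5/4 - 5/4 * real n powr (-3/2)) ^ r \<and>
      \<not> has_zero_sum_subseq (cyclic_power n r) (2 * n) xs"
    by (rule ex_seq_without_zero_sum)
  \<comment> \<open>The sequence is strictly shorter than the constant, which makes the bound
    strict.\<close>
  with length_less_egz_const[OF \<open>n \<ge> 1\<close>]
  show "real n / 2 * (5/4 - 5/4 * real n powr (-3/2)) ^ r
      < real (egz_const (2 * n) (cyclic_power n r))"
    by (meson le_less_trans of_nat_less_iff)
\<comment> \<open>The growth condition remains: the error is 5/4 times the comparison function,
  independently of \<open>r\<close>.\<close>
qed simp

end
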